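(* Let $k,n$ be integers with $0\le k\le n$. Then for every integer $i$ with $0\le i\le n-k$, $$\sum_{l=i}^{n-k}(-1)^{l-i}\binom{n-k}{l}\frac{(k+1/2)_l}{(2k+1)_l}\binom{l}{i}=4^k\binom{n+k}{n}^{-1}\binom{n}{k}^{-1}\binom{2n-2i}{2k}\binom{n}{i}r_{n,k+i},$$ and for every integer $j$ with $0\le j\le n-k$, $$\sum_{l=j}^{n-k}\binom{2n-2l}{2k}\binom{n}{l}\binom{l}{j}r_{n,k+l}=4^{-k}\binom{n+k}{n}\binom{n}{k}\binom{n-k}{j}\frac{(k+1/2)_j}{(2k+1)_j}.$$
   Context: Notation: $(y)_0:=1$, $(y)_s:=y(y+1)\cdots(y+s-1)$ for $s\ge1$; for $0\le j\le n$, $r_{n,j}:=\binom{n}{j}^{-1}4^{-n}\binom{2j}{j}\binom{2n-2j}{n-j}$. *)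

theory Defs
  imports Complex_Main
begin

(* Used only for j \<le> n, where the truncated subtraction 2 * n - 2 * j is exact. *)
definition r :: "nat \<Rightarrow> nat \<Rightarrow> real" where
  "r n j = inverse (real (n choose j)) * inverse (4 ^ n)
             * real ((2 * j) choose j) * real ((2 * n - 2 * j) choose (n - j))"

end

theory Submission
  imports Defs
begin

text \<open>
  Put \<open>N = n - k\<close>, \<open>a = k + 1/2\<close> and \<open>c = 2 * k + 1\<close>. Writing all Pochhammer symbols and
  binomial coefficients as factorials shows that, up to a constant \<open>W\<close> that is independent
  of \<open>i\<close>, the weight \<open>r n (k + i)\<close> with its two binomial factors is the term
  \<open>(N choose i) (a)\<^sub>i (a)\<^sub>N\<^sub>-\<^sub>i / (c)\<^sub>N\<close> of the Chu--Vandermonde convolution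
  (\<open>weighted_r_eq_convolution_term\<close>). In terms of it, both identities become forms of
  Chu--Vandermonde:

  \<^item> the first is the terminating sum \<open>\<^sub>2F\<^sub>1(-M, a; c; 1) = (c - a)\<^sub>M / (c)\<^sub>M\<close> with \<open>c - a = a\<close>
    (\<open>alternating_binomial_transform_pochhammer\<close>);

  \<^item> the second is \<open>\<Sum>\<^sub>m (M choose m) (x)\<^sub>m (y)\<^sub>M\<^sub>-\<^sub>m = (x + y)\<^sub>M\<close> with \<open>x = a + j\<close>, \<open>y = a\<close>, where
    \<open>a + a = c\<close> makes the right-hand side \<open>(c + j)\<^sub>M\<close>, which for \<open>M = N - j\<close> is \<open>(c)\<^sub>N / (c)\<^sub>j\<close>
    (\<open>binomial_transform_pochhammer_product\<close>).

  In each case the extra factor \<open>l choose i\<close> (or \<open>l choose j\<close>) merely shifts the parameters, by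
  \<open>(N choose l) (l choose i) = (N choose i) ((N - i) choose (l - i))\<close>.
\<close>

section \<open>Chu--Vandermonde sums\<close>

text \<open>
  The terminating Gauss sum. Pascal's rule gives, for the sum \<open>f M a c\<close>, the recurrence
  \<open>f (M + 1) a c = f M a c - (a / c) * f M (a + 1) (c + 1)\<close>; both values on the right have the
  same numerator \<open>(c - a)\<^sub>M\<close>, because \<open>c - a\<close> is unchanged by the shift. Hence the induction
  has to be over all \<open>a\<close> and \<open>c\<close> simultaneously.
\<close>
lemma pochhammer_alternating_binomial_sum:
  fixes a c :: "'a :: field_char_0"
  assumes "pochhammer c M \<noteq> 0"
  shows "(\<Sum>m\<le>M. (- 1) ^ m * of_nat (M choose m) * (pochhammer a m / pochhammer c m))
         = pochhammer (c - a) M / pochhammer c M"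
  using assms
proof (induction M arbitrary: a c)
  case 0
  then show ?case by simp
next
  case (Suc M)
  define f where "f M a c = (\<Sum>m\<le>M. (- 1) ^ m * of_nat (M choose m)
      * (pochhammer a m / pochhammer c m))" for M and a c :: 'a
  have nz: "pochhammer c M \<noteq> 0" "c + of_nat M \<noteq> 0" "c \<noteq> 0" "pochhammer (c + 1) M \<noteq> 0"
    using Suc.prems pochhammer_Suc[of c M] pochhammer_rec[of c M] by auto
  have step: "c * pochhammer (c + 1) M = pochhammer c M * (c + of_nat M)"
    using pochhammer_Suc[of c M] pochhammer_rec[of c M] by simp
  have aux: "x / p - a * x / (p * (c + d)) = x * (c - a + d) / (p * (c + d))"
    if "p \<noteq> 0" "c + d \<noteq> 0" for x p d :: 'a
    using that by (simp add: divide_simps) (simp add: algebra_simps)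
  let ?g = "\<lambda>m. (- 1) ^ m * (pochhammer a m / pochhammer c m)"
  have "f (Suc M) a c = ?g 0 + (\<Sum>m\<le>M. of_nat (Suc M choose Suc m) * ?g (Suc m))"
    unfolding f_def by (subst sum.atMost_Suc_shift) (simp add: mult_ac)
  also have "\<dots> = (?g 0 + (\<Sum>m\<le>M. of_nat (M choose Suc m) * ?g (Suc m)))
      + (\<Sum>m\<le>M. of_nat (M choose m) * ?g (Suc m))"
    by (simp only: binomial_Suc_Suc of_nat_add distrib_right sum.distrib
        add.assoc add.commute add.left_commute)
  also have "?g 0 + (\<Sum>m\<le>M. of_nat (M choose Suc m) * ?g (Suc m))
      = (\<Sum>m\<le>Suc M. of_nat (M choose m) * ?g m)"
    by (subst sum.atMost_Suc_shift) simp
  also have "\<dots> = f M a c"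
    unfolding f_def by (simp add: mult_ac)
  also have "(\<Sum>m\<le>M. of_nat (M choose m) * ?g (Suc m)) = - (a / c) * f M (a + 1) (c + 1)"
    unfolding f_def sum_distrib_left
    by (intro sum.cong refl) (simp add: pochhammer_rec)
  finally have "f (Suc M) a c
      = pochhammer (c - a) M / pochhammer c M
        - a * pochhammer (c - a) M / (c * pochhammer (c + 1) M)"
    using Suc.IH[of c a] Suc.IH[of "c + 1" "a + 1"] nz by (simp add: f_def)
  also have "\<dots> = pochhammer (c - a) M * (c - a + of_nat M) / (pochhammer c M * (c + of_nat M))"
    unfolding step using aux nz(1,2) by simp
  finally show ?case
    by (simp add: f_def pochhammer_Suc)
qed

text \<open>
  Choosing \<open>l\<close> of \<open>N\<close> objects and \<open>i\<close> among these is choosing the \<open>i\<close> objects first and then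
  \<open>m = l - i\<close> of the others. This removes the factor \<open>l choose i\<close> from a binomial transform.
\<close>
lemma sum_binomial_subset_shift:
  fixes f :: "nat \<Rightarrow> 'a :: comm_semiring_1"
  assumes "i \<le> N"
  shows "(\<Sum>l = i..N. of_nat (N choose l) * of_nat (l choose i) * f l)
         = of_nat (N choose i) * (\<Sum>m\<le>N - i. of_nat ((N - i) choose m) * f (i + m))"
proof -
  have "(\<Sum>l = i..N. of_nat (N choose l) * of_nat (l choose i) * f l)
      = (\<Sum>l = i..N. of_nat (N choose i) * (of_nat ((N - i) choose (l - i)) * f l))"
    by (intro sum.cong refl)
       (simp flip: of_nat_mult mult.assoc add: choose_mult)
  also have "\<dots> = (\<Sum>m\<le>N - i. of_nat (N choose i) * (of_nat ((N - i) choose m) * f (i + m)))"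
    using assms
    by (intro sum.reindex_bij_witness[of _ "\<lambda>m. i + m" "\<lambda>l. l - i"]) auto
  finally show ?thesis by (simp add: sum_distrib_left)
qed

lemma alternating_binomial_transform_pochhammer:
  fixes a c :: "'a :: field_char_0"
  assumes "i \<le> N" and nz: "pochhammer c N \<noteq> 0"
  shows "(\<Sum>l = i..N. (- 1) ^ (l - i) * of_nat (N choose l)
            * (pochhammer a l / pochhammer c l) * of_nat (l choose i))
         = of_nat (N choose i) * pochhammer a i * pochhammer (c - a) (N - i) / pochhammer c N"
proof -
  have split: "pochhammer c N = pochhammer c i * pochhammer (c + of_nat i) (N - i)"
    using pochhammer_product[OF assms(1)] .
  have "(\<Sum>l = i..N. (- 1) ^ (l - i) * of_nat (N choose l)
            * (pochhammer a l / pochhammer c l) * of_nat (l choose i))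
      = (\<Sum>l = i..N. of_nat (N choose l) * of_nat (l choose i)
            * ((- 1) ^ (l - i) * (pochhammer a l / pochhammer c l)))"
    by (simp add: mult_ac)
  also have "\<dots> = of_nat (N choose i) * (\<Sum>m\<le>N - i. of_nat ((N - i) choose m)
            * ((- 1) ^ m * (pochhammer a (i + m) / pochhammer c (i + m))))"
    by (subst sum_binomial_subset_shift[OF assms(1)]) simp
  also have "(\<Sum>m\<le>N - i. of_nat ((N - i) choose m)
            * ((- 1) ^ m * (pochhammer a (i + m) / pochhammer c (i + m))))
      = pochhammer a i / pochhammer c i * (\<Sum>m\<le>N - i. (- 1) ^ m * of_nat ((N - i) choose m)
            * (pochhammer (a + of_nat i) m / pochhammer (c + of_nat i) m))"
    unfolding sum_distrib_left
    by (intro sum.cong refl) (simp add: pochhammer_product')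
  also have "(\<Sum>m\<le>N - i. (- 1) ^ m * of_nat ((N - i) choose m)
            * (pochhammer (a + of_nat i) m / pochhammer (c + of_nat i) m))
      = pochhammer (c - a) (N - i) / pochhammer (c + of_nat i) (N - i)"
    using pochhammer_alternating_binomial_sum[of "c + of_nat i" "N - i" "a + of_nat i"] nz split
    by simp
  finally show ?thesis using split by simp
qed

lemma binomial_transform_pochhammer_product:
  fixes a b :: "'a :: comm_ring_1"
  assumes "j \<le> N"
  shows "(\<Sum>l = j..N. of_nat (N choose l) * of_nat (l choose j)
            * (pochhammer a l * pochhammer b (N - l)))
         = of_nat (N choose j) * pochhammer a j * pochhammer (a + b + of_nat j) (N - j)"
proof -
  have "(\<Sum>m\<le>N - j. of_nat ((N - j) choose m)
            * (pochhammer a (j + m) * pochhammer b (N - (j + m))))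
      = pochhammer a j * pochhammer ((a + of_nat j) + b) (N - j)"
    unfolding pochhammer_binomial_sum[of "a + of_nat j"] sum_distrib_left
    by (intro sum.cong refl) (simp add: pochhammer_product' mult_ac)
  then show ?thesis
    by (subst sum_binomial_subset_shift[OF assms]) (simp add: add_ac mult_ac)
qed

section \<open>Factorial form of the weights\<close>

text \<open>
  Passing from \<open>m\<close> to \<open>m + 1\<close> multiplies \<open>fact (2 * (k + m))\<close> by
  \<open>(2 * u + 2) * (2 * u + 1) = 4 * (u + 1) * (u + 1/2)\<close> with \<open>u = k + m\<close>: the last of
  these is the next Pochhammer factor, the others are absorbed by \<open>4 ^ m\<close> and \<open>fact (k + m)\<close>.
\<close>
lemma pochhammer_half_shift:
  "pochhammer (real k + 1 / 2) m = fact (2 * (k + m)) * fact k / (4 ^ m * fact (k + m) * fact (2 * k))"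
proof (induction m)
  case (Suc m)
  have f: "fact (2 * (k + Suc m))
      = (2 * real (k + m) + 2) * (2 * real (k + m) + 1) * fact (2 * (k + m))"
    by (simp add: algebra_simps)
  have g: "fact (k + Suc m) = (real (k + m) + 1) * fact (k + m)"
    by (simp add: algebra_simps)
  have odd_even: "(2 * real (k + m) + 2) * (2 * real (k + m) + 1)
      = 4 * (real (k + m) + 1) * (real k + 1 / 2 + real m)"
    by (simp add: algebra_simps)
  have cancel: "F * K / (Q * G * T) * w = 4 * p * w * F * K / (4 * Q * (p * G) * T)"
    if "p \<noteq> 0" for F K Q G T w p :: real
    using that by (simp add: mult_ac)
  show ?case
    unfolding pochhammer_Suc Suc.IH f g odd_even power_Suc by (rule cancel) linarith
qed simp

lemma pochhammer_nat_shift: "pochhammer (real c + 1) m = fact (c + m) / fact c"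
  using pochhammer_product'[of "1::real" c m]
  by (simp add: pochhammer_fact[symmetric] field_simps)

text \<open>
  This is where the particular numbers \<open>r n j\<close> enter: the value claimed for the first sum, which is
  also the summand of the second up to a constant and the factor \<open>l choose j\<close>, becomes a
  Chu--Vandermonde term with both parameters equal to \<open>k + 1/2\<close>.
\<close>
lemma weighted_r_eq_convolution_term:
  fixes k n i :: nat
  assumes "k \<le> n" "i \<le> n - k"
  shows "4 ^ k * inverse (real ((n + k) choose n)) * inverse (real (n choose k))
           * real ((2 * n - 2 * i) choose (2 * k)) * real (n choose i) * r n (k + i)
         = real ((n - k) choose i) * pochhammer (real k + 1 / 2) i
           * pochhammer (real k + 1 / 2) (n - k - i) / pochhammer (2 * real k + 1) (n - k)"
proof -
  \<comment> \<open>With \<open>n = k + i + q\<close> no truncated difference remains inside a factorial.\<close>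
  define q where "q = n - k - i"
  have n: "n = k + i + q" using assms by (simp add: q_def)
  have "2 * k + (n - k) = n + k" using assms by simp
  then have P: "pochhammer (2 * real k + 1) (n - k) = fact (n + k) / fact (2 * k)"
    using pochhammer_nat_shift[of "2 * k" "n - k"] by (simp add: add.commute)
  have B: "real ((n + k) choose n) = fact (n + k) / (fact n * fact k)"
    "real (n choose k) = fact n / (fact k * fact (i + q))"
    "real ((2 * n - 2 * i) choose (2 * k)) = fact (2 * (k + q)) / (fact (2 * k) * fact (2 * q))"
    "real (n choose i) = fact n / (fact i * fact (k + q))"
    "real ((n - k) choose i) = fact (i + q) / (fact i * fact q)"
    by (subst binomial_fact; simp add: n)+
  have R: "r n (k + i) = fact (2 * (k + i)) * fact (2 * q)
      / (4 ^ n * fact n * fact (k + i) * fact q)"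
  proof -
    have "real (n choose (k + i)) = fact n / (fact (k + i) * fact q)"
      "real ((2 * (k + i)) choose (k + i)) = fact (2 * (k + i)) / (fact (k + i) * fact (k + i))"
      "real ((2 * n - 2 * (k + i)) choose (n - (k + i))) = fact (2 * q) / (fact q * fact q)"
      by (subst binomial_fact; simp add: n add.commute)+
    then show ?thesis unfolding r_def by (simp add: inverse_eq_divide mult_ac)
  qed
  \<comment> \<open>The letters stand for the powers of \<open>4\<close> and for the factorials, so that they are cancelled
      as atoms.\<close>
  have cancel: "K * inverse (F / (Fn * Fk)) * inverse (Fn / (Fk * Fiq)) * (X / (T * D))
        * (Fn / (Fi * Fkq)) * (E * D / (K * I * Q * Fn * Fki * Fq))
      = Fiq / (Fi * Fq) * (E * Fk / (I * Fki * T)) * (X * Fk / (Q * Fkq * T)) / (F / T)"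
    if "K \<noteq> 0" "Fn \<noteq> 0" "T \<noteq> 0" "D \<noteq> 0" for K F Fn Fk Fiq X T D Fi Fkq E I Q Fki Fq :: real
    using that by (simp add: mult_ac)
  have four: "(4::real) ^ n = 4 ^ k * 4 ^ i * 4 ^ q" by (simp add: n power_add)
  show ?thesis
    unfolding P B R four pochhammer_half_shift q_def[symmetric] by (rule cancel) simp_all
qed

section \<open>The two identities\<close>

theorem mainTheorem9:
  fixes k n :: nat
  assumes "k \<le> n"
  shows "(\<forall>i\<le>n - k.
            (\<Sum>l = i..n - k. (- 1) ^ (l - i) * real ((n - k) choose l)
                * (pochhammer (real k + 1 / 2) l / pochhammer (2 * real k + 1) l)
                * real (l choose i))
            = 4 ^ k * inverse (real ((n + k) choose n)) * inverse (real (n choose k))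
                * real ((2 * n - 2 * i) choose (2 * k)) * real (n choose i) * r n (k + i))
       \<and> (\<forall>j\<le>n - k.
            (\<Sum>l = j..n - k. real ((2 * n - 2 * l) choose (2 * k)) * real (n choose l)
                * real (l choose j) * r n (k + l))
            = inverse (4 ^ k) * real ((n + k) choose n) * real (n choose k)
                * real ((n - k) choose j)
                * (pochhammer (real k + 1 / 2) j / pochhammer (2 * real k + 1) j))"
proof -
  define N where "N = n - k"
  define a where "a = real k + 1 / 2"
  define c where "c = 2 * real k + 1"
  define W where "W = 4 ^ k * inverse (real ((n + k) choose n)) * inverse (real (n choose k))"
  \<comment> \<open>The relation between the parameters on which both evaluations rest.\<close>
  have c: "c = a + a" by (simp add: a_def c_def)
  have nz: "pochhammer c m \<noteq> 0" for m
    using pochhammer_pos[of c m] by (simp add: c_def)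
  have W: "inverse W = inverse (4 ^ k) * real ((n + k) choose n) * real (n choose k)"
    by (simp add: W_def)
  have "W \<noteq> 0" using assms by (simp add: W_def)
  have weight: "W * real ((2 * n - 2 * i) choose (2 * k)) * real (n choose i) * r n (k + i)
      = real (N choose i) * pochhammer a i * pochhammer a (N - i) / pochhammer c N"
    if "i \<le> N" for i
    using weighted_r_eq_convolution_term[OF assms] that by (simp add: W_def N_def a_def c_def)
  have first: "(\<Sum>l = i..N. (- 1) ^ (l - i) * real (N choose l)
        * (pochhammer a l / pochhammer c l) * real (l choose i))
      = W * real ((2 * n - 2 * i) choose (2 * k)) * real (n choose i) * r n (k + i)"
    if "i \<le> N" for i
    using alternating_binomial_transform_pochhammer[OF that nz] weight[OF that] by (simp add: c)
  have second: "(\<Sum>l = j..N. real ((2 * n - 2 * l) choose (2 * k)) * real (n choose l)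
        * real (l choose j) * r n (k + l))
      = inverse W * real (N choose j) * (pochhammer a j / pochhammer c j)"
    (is "?S = _") if "j \<le> N" for j
  proof -
    have "W * ?S = (\<Sum>l = j..N. (W * real ((2 * n - 2 * l) choose (2 * k)) * real (n choose l)
        * r n (k + l)) * real (l choose j))"
      by (simp add: sum_distrib_left mult_ac)
    also have "\<dots> = (\<Sum>l = j..N. real (N choose l) * real (l choose j)
        * (pochhammer a l * pochhammer a (N - l))) / pochhammer c N"
      unfolding sum_divide_distrib by (intro sum.cong refl) (simp add: weight)
    also have "\<dots> = real (N choose j) * pochhammer a j * pochhammer (c + real j) (N - j)
        / pochhammer c N"
      by (simp add: binomial_transform_pochhammer_product[OF that] c)
    also have "\<dots> = real (N choose j) * (pochhammer a j / pochhammer c j)"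
      using pochhammer_product[OF that, of c] nz[of N] by simp
    finally have "W * ?S = real (N choose j) * (pochhammer a j / pochhammer c j)" .
    moreover have "s = inverse W * x * y" if "W * s = x * y" for s x y
      using that \<open>W \<noteq> 0\<close> by (simp add: divide_simps mult.commute)
    ultimately show ?thesis by blast
  qed
  show ?thesis
    using first second unfolding N_def a_def c_def W W_def[symmetric] by simp
qed

end
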